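(* Consider the $K$-server pricing system with Poisson arrivals, with the number of servers $K\in\mathbb{N}$, the arrival rate $\lambda>0$ and the valuation distribution $G$ fixed, and let $\theta^*(\mu)=\max_{\mathbf p\in\mathbb{R}_+^K}R(K,\mathbf p)$ be its optimal revenue rate as a function of the service rate $\mu>0$. Then: (a) $\theta^*(\mu)$ is (strictly) increasing in $\mu$; (b) $\theta^*(\mu)/\mu$ is (strictly) decreasing in $\mu$.
   Context: Model: jobs arrive according to a Poisson process of rate $\lambda$ at a system of $K$ servers with no waiting room; service times are i.i.d. exponential with mean $1/\mu$; valuations are i.i.d., independent of everything else, positive, with continuous distribution function $G$ and finite mean; $\overline{G}(u)=P(V\ge u)$ for a generic valuation $V$. A price vector is $\mathbf p=(p_0,\dots,p_{K-1})\in\mathbb{R}_+^K$; a job finding $k\le K-1$ busy servers joins and pays $p_k$ iff its valuation is at least $p_k$; otherwise, or if all $K$ servers are busy, it leaves. The revenue rate $R(K,\mathbf p)=\lim_{t\to\infty}\mathbb{E}[\text{revenue in }[0,t]]/t$ equals $\sum_{k=0}^{K-1}\pi_k\,\lambda\,\overline{G}(p_k)\,p_k$, where, with $\rho=\lambda/\mu$, $\pi_k=\pi_0\frac{\rho^k}{k!}\prod_{j=0}^{k-1}\overline{G}(p_j)$ for $1\le k\le K$ and $\pi_0=\big[1+\sum_{k=1}^K\frac{\rho^k}{k!}\prod_{j=0}^{k-1}\overline{G}(p_j)\big]^{-1}$. Standing assumption: a finite optimal price vector (a maximizer of $R(K,\cdot)$) exists. *)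

theory Defs
  imports "HOL-Probability.Probability"
begin

text \<open>
  A valuation distribution is given as its law \<open>D\<close> on the reals, so that \<open>G = cdf D\<close>;
  \<open>tail D u\<close> is the probability that the valuation is at least \<open>u\<close>.
\<close>

definition valuation_distribution :: "real measure \<Rightarrow> bool" where
  "valuation_distribution D \<longleftrightarrow>
     real_distribution D \<and> (AE v in D. 0 < v) \<and>
     continuous_on UNIV (cdf D) \<and> integrable D (\<lambda>v. v)"

definition tail :: "real measure \<Rightarrow> real \<Rightarrow> real" where
  "tail D u = measure D {u..}"

text \<open>
  Price vectors of length \<open>K\<close> are functions on \<open>{..<K}\<close>, extended by \<^const>\<open>undefined\<close> elsewhere.
\<close>

definition price_vectors :: "nat \<Rightarrow> (nat \<Rightarrow> real) set" where
  "price_vectors K = {..<K} \<rightarrow>\<^sub>E {0..}"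

definition state_weight :: "real measure \<Rightarrow> real \<Rightarrow> real \<Rightarrow> (nat \<Rightarrow> real) \<Rightarrow> nat \<Rightarrow> real" where
  "state_weight D lam mu p k = (lam / mu) ^ k / fact k * (\<Prod>j<k. tail D (p j))"

definition state_prob ::
  "real measure \<Rightarrow> nat \<Rightarrow> real \<Rightarrow> real \<Rightarrow> (nat \<Rightarrow> real) \<Rightarrow> nat \<Rightarrow> real" where
  "state_prob D K lam mu p k =
     inverse (1 + (\<Sum>i=1..K. state_weight D lam mu p i)) * state_weight D lam mu p k"

text \<open>
  The revenue rate is defined by its closed form. Lemma \<open>long_run_revenue_rate\<close> below shows that it
  is the long-run average of the expected revenue of the underlying Markov chain.
\<close>

definition revenue_rate ::
  "real measure \<Rightarrow> nat \<Rightarrow> real \<Rightarrow> real \<Rightarrow> (nat \<Rightarrow> real) \<Rightarrow> real" where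
  "revenue_rate D K lam mu p =
     (\<Sum>k<K. state_prob D K lam mu p k * lam * tail D (p k) * p k)"

text \<open>
  The optimum is a maximum, not a supremum: \<^const>\<open>Greatest\<close> picks the largest attained value and is
  meaningful only if a maximizer exists.
\<close>

definition optimal_revenue_rate :: "real measure \<Rightarrow> nat \<Rightarrow> real \<Rightarrow> real \<Rightarrow> real" where
  "optimal_revenue_rate D K lam mu =
     (GREATEST r. r \<in> revenue_rate D K lam mu ` price_vectors K)"

lemma optimal_revenue_rate_eq:
  assumes "is_arg_max (revenue_rate D K lam mu) (\<lambda>p. p \<in> price_vectors K) p"
  shows "optimal_revenue_rate D K lam mu = revenue_rate D K lam mu p"
  unfolding optimal_revenue_rate_def
  using assms by (intro Greatest_equality) (auto simp: is_arg_max_linorder)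

text \<open>
  The number of busy servers is a birth-death chain on \<open>{..K}\<close> with birth rates
  \<open>lam * tail D (p k)\<close> for \<open>k < K\<close> and death rates \<open>k * mu\<close>; \<open>P k t\<close> is the probability of \<open>k\<close> busy
  servers at time \<open>t\<close>, and these are its Kolmogorov forward equations.
\<close>

definition forward_equations ::
  "real measure \<Rightarrow> nat \<Rightarrow> real \<Rightarrow> real \<Rightarrow> (nat \<Rightarrow> real) \<Rightarrow> (nat \<Rightarrow> real \<Rightarrow> real) \<Rightarrow> bool" where
  "forward_equations D K lam mu p P \<longleftrightarrow>
     (\<forall>k\<le>K. \<forall>t\<ge>0. (P k has_real_derivative
        (if 0 < k then lam * tail D (p (k - 1)) * P (k - 1) t else 0)
        + (if k < K then real (k + 1) * mu * P (k + 1) t else 0)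
        - ((if k < K then lam * tail D (p k) else 0) + real k * mu) * P k t) (at t within {0..}))"

lemma tail_nonneg: "0 \<le> tail D u"
  by (simp add: tail_def)

lemma state_weight_0 [simp]: "state_weight D lam mu p 0 = 1"
  by (simp add: state_weight_def)

lemma state_weight_nonneg: "0 \<le> lam \<Longrightarrow> 0 \<le> mu \<Longrightarrow> 0 \<le> state_weight D lam mu p k"
  by (simp add: state_weight_def tail_nonneg prod_nonneg)

lemma state_weight_balance:
  assumes "0 < mu"
  shows "lam * tail D (p k) * state_weight D lam mu p k
    = real (k + 1) * mu * state_weight D lam mu p (k + 1)"
proof -
  have "state_weight D lam mu p (k + 1)
    = lam / mu / real (k + 1) * tail D (p k) * state_weight D lam mu p k"
    by (simp add: state_weight_def mult.assoc mult.left_commute mult.commute)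
  then show ?thesis using assms by (simp del: of_nat_add of_nat_Suc)
qed

lemma sum_state_weight:
  "(\<Sum>i\<le>K. state_weight D lam mu p i) = 1 + (\<Sum>i=1..K. state_weight D lam mu p i)"
  by (simp add: sum.atMost_shift lessThan_atLeast0 atLeastLessThanSuc_atLeastAtMost
      sum.shift_bounds_cl_Suc_ivl flip: sum.shift_bounds_Suc_ivl)

lemma forward_equations_cumulative:
  assumes fe: "forward_equations D K lam mu p P" and "k < K" "0 \<le> t"
  shows "((\<lambda>t. \<Sum>j\<le>k. P j t) has_real_derivative
    real (k + 1) * mu * P (k + 1) t - lam * tail D (p k) * P k t) (at t within {0..})"
  using \<open>k < K\<close>
proof (induction k)
  case 0
  then show ?case
    using fe \<open>0 \<le> t\<close> unfolding forward_equations_def by (auto dest!: spec[of _ 0] spec[of _ t])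
next
  case (Suc k)
  have "(P (Suc k) has_real_derivative lam * tail D (p k) * P k t
      + real (Suc k + 1) * mu * P (Suc k + 1) t
      - (lam * tail D (p (Suc k)) + real (Suc k) * mu) * P (Suc k) t) (at t within {0..})"
    using fe \<open>0 \<le> t\<close> Suc.prems unfolding forward_equations_def
    by (auto dest!: spec[of _ "Suc k"] spec[of _ t])
  moreover have "((\<lambda>t. \<Sum>j\<le>k. P j t) has_real_derivative
    real (k + 1) * mu * P (k + 1) t - lam * tail D (p k) * P k t) (at t within {0..})"
    using Suc by simp
  ultimately have "((\<lambda>t. (\<Sum>j\<le>k. P j t) + P (Suc k) t) has_real_derivative
     (real (k + 1) * mu * P (k + 1) t - lam * tail D (p k) * P k t)
     + (lam * tail D (p k) * P k t
      + real (Suc k + 1) * mu * P (Suc k + 1) t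
      - (lam * tail D (p (Suc k)) + real (Suc k) * mu) * P (Suc k) t)) (at t within {0..})"
    by (intro DERIV_add)
  then show ?case
    by (simp add: algebra_simps)
qed

lemma long_run_state_prob:
  assumes pos: "0 < lam" "0 < mu"
    and fe: "forward_equations D K lam mu p P"
    and nonneg: "\<And>k t. k \<le> K \<Longrightarrow> 0 \<le> t \<Longrightarrow> 0 \<le> P k t"
    and total: "\<And>t. 0 \<le> t \<Longrightarrow> (\<Sum>k\<le>K. P k t) = 1"
    and "k \<le> K"
  shows "((\<lambda>t. integral {0..t} (P k) / t) \<longlongrightarrow> state_prob D K lam mu p k) at_top"
proof -
  define A where "A k t = integral {0..t} (P k) / t" for k and t :: real
  define w where "w = state_weight D lam mu p"
  have cont: "continuous_on {0..t} (P k)" if "k \<le> K" for k t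
  proof -
    have "continuous_on {0..} (P k)"
      using fe that unfolding forward_equations_def
      by (intro DERIV_continuous_on) auto
    then show ?thesis by (rule continuous_on_subset) auto
  qed
  have int: "P k integrable_on {0..t}" if "k \<le> K" for k t
    using cont[OF that] by (rule integrable_continuous_interval)
  have le1: "(\<Sum>j\<le>k. P j t) \<le> 1" "0 \<le> (\<Sum>j\<le>k. P j t)" if "k \<le> K" "0 \<le> t" for k t
  proof -
    have "(\<Sum>j\<le>k. P j t) \<le> (\<Sum>j\<le>K. P j t)"
      using that by (intro sum_mono2) (auto intro: nonneg)
    then show "(\<Sum>j\<le>k. P j t) \<le> 1" using total that by simp
    show "0 \<le> (\<Sum>j\<le>k. P j t)" using that by (intro sum_nonneg nonneg) auto
  qed
  have flow: "((\<lambda>t. real (k + 1) * mu * A (k + 1) t - lam * tail D (p k) * A k t) \<longlongrightarrow> 0) at_top"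
    if "k < K" for k
  proof (rule Lim_null_comparison)
    show "((\<lambda>t::real. 1 / t) \<longlongrightarrow> 0) at_top"
      by real_asymp
    show "\<forall>\<^sub>F t in at_top. norm (real (k + 1) * mu * A (k + 1) t - lam * tail D (p k) * A k t) \<le> 1 / t"
      using eventually_gt_at_top[of 0]
    proof eventually_elim
      case (elim t)
      let ?S = "\<lambda>t. \<Sum>j\<le>k. P j t"
      have "((\<lambda>s. real (k + 1) * mu * P (k + 1) s - lam * tail D (p k) * P k s)
          has_integral ?S t - ?S 0) {0..t}"
      proof (rule fundamental_theorem_of_calculus)
        fix x assume "x \<in> {0..t}"
        then have "(?S has_real_derivative
            real (k + 1) * mu * P (k + 1) x - lam * tail D (p k) * P k x) (at x within {0..t})"
          by (intro DERIV_subset[OF forward_equations_cumulative[OF fe \<open>k < K\<close>]]) auto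
        then show "(?S has_vector_derivative
            real (k + 1) * mu * P (k + 1) x - lam * tail D (p k) * P k x) (at x within {0..t})"
          by (simp add: has_real_derivative_iff_has_vector_derivative)
      qed (use elim in auto)
      moreover have "((\<lambda>s. real (k + 1) * mu * P (k + 1) s - lam * tail D (p k) * P k s)
          has_integral real (k + 1) * mu * integral {0..t} (P (k + 1))
            - lam * tail D (p k) * integral {0..t} (P k)) {0..t}"
        using \<open>k < K\<close> int
        by (intro has_integral_diff has_integral_mult_right integrable_integral) auto
      ultimately have "real (k + 1) * mu * integral {0..t} (P (k + 1))
            - lam * tail D (p k) * integral {0..t} (P k) = ?S t - ?S 0"
        by (rule has_integral_unique[symmetric])
      then have "real (k + 1) * mu * A (k + 1) t - lam * tail D (p k) * A k t = (?S t - ?S 0) / t"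
        by (simp add: A_def diff_divide_distrib flip: times_divide_eq_right)
           (metis diff_divide_distrib times_divide_eq_right)
      moreover have "\<bar>?S t - ?S 0\<bar> \<le> 1"
        using le1[of k t] le1[of k 0] elim that by linarith
      ultimately show ?case using elim by (simp add: divide_right_mono)
    qed
  qed
  have rel: "((\<lambda>t. A k t - w k * A 0 t) \<longlongrightarrow> 0) at_top" if "k \<le> K" for k
    using that
  proof (induction k)
    case 0
    then show ?case by (simp add: w_def)
  next
    case (Suc k)
    let ?c = "real (k + 1) * mu" and ?b = "lam * tail D (p k)"
    have "((\<lambda>t. (1 / ?c) * ((?c * A (k + 1) t - ?b * A k t) + ?b * (A k t - w k * A 0 t))) \<longlongrightarrow>
        (1 / ?c) * (0 + ?b * 0)) at_top"
      using Suc by (intro tendsto_intros flow) auto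
    moreover have "(1 / ?c) * ((?c * A (k + 1) t - ?b * A k t) + ?b * (A k t - w k * A 0 t))
      = A (Suc k) t - w (Suc k) * A 0 t" for t
    proof -
      have "?c \<noteq> 0" using pos by simp
      have "?b * w k = ?c * w (Suc k)"
        using state_weight_balance[OF pos(2)] by (simp add: w_def)
      then have "(?c * A (k + 1) t - ?b * A k t) + ?b * (A k t - w k * A 0 t)
        = ?c * (A (Suc k) t - w (Suc k) * A 0 t)"
        by (simp add: right_diff_distrib flip: mult.assoc)
      then show ?thesis using \<open>?c \<noteq> 0\<close> by simp
    qed
    ultimately show ?case by simp
  qed
  define W where "W = (\<Sum>k\<le>K. w k)"
  have "1 \<le> W"
    unfolding W_def w_def sum_state_weight
    using pos by (simp add: sum_nonneg state_weight_nonneg)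
  have "((\<lambda>t. \<Sum>k\<le>K. A k t - w k * A 0 t) \<longlongrightarrow> (\<Sum>k\<le>K. 0)) at_top"
    using rel by (intro tendsto_sum) auto
  then have "((\<lambda>t. (1 - (\<Sum>k\<le>K. A k t - w k * A 0 t)) / W) \<longlongrightarrow> (1 - (\<Sum>k\<le>K. 0)) / W) at_top"
    using \<open>1 \<le> W\<close> by (intro tendsto_divide tendsto_diff tendsto_const) auto
  moreover have "\<forall>\<^sub>F t in at_top. (1 - (\<Sum>k\<le>K. A k t - w k * A 0 t)) / W = A 0 t"
    using eventually_gt_at_top[of 0]
  proof eventually_elim
    case (elim t)
    have "(\<Sum>k\<le>K. integral {0..t} (P k)) = integral {0..t} (\<lambda>s. \<Sum>k\<le>K. P k s)"
      using int by (intro integral_sum[symmetric]) auto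
    also have "\<dots> = integral {0..t} (\<lambda>s. 1)"
      using total by (intro integral_cong) auto
    also have "\<dots> = t" using elim by simp
    finally have "(\<Sum>k\<le>K. A k t) = 1"
      using elim by (simp add: A_def flip: sum_divide_distrib)
    then have "1 - (\<Sum>k\<le>K. A k t - w k * A 0 t) = W * A 0 t"
      by (simp add: W_def sum_subtractf sum_distrib_right)
    then show ?case using \<open>1 \<le> W\<close> by simp
  qed
  ultimately have A0: "(A 0 \<longlongrightarrow> 1 / W) at_top"
    by (auto elim: Lim_transform_eventually)
  have "((\<lambda>t. (A k t - w k * A 0 t) + w k * A 0 t) \<longlongrightarrow> 0 + w k * (1 / W)) at_top"
    using rel[OF \<open>k \<le> K\<close>] A0 by (intro tendsto_intros)
  moreover have "0 + w k * (1 / W) = state_prob D K lam mu p k"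
    by (simp add: state_prob_def w_def W_def sum_state_weight field_simps)
  ultimately show ?thesis by (simp add: A_def)
qed

text \<open>
  In state \<open>k < K\<close> revenue accrues at the expected rate \<open>lam * tail D (p k) * p k\<close>, so the integral
  below is the expected revenue up to time \<open>t\<close>.
\<close>

lemma long_run_revenue_rate:
  assumes pos: "0 < lam" "0 < mu"
    and fe: "forward_equations D K lam mu p P"
    and nonneg: "\<And>k t. k \<le> K \<Longrightarrow> 0 \<le> t \<Longrightarrow> 0 \<le> P k t"
    and total: "\<And>t. 0 \<le> t \<Longrightarrow> (\<Sum>k\<le>K. P k t) = 1"
  shows "((\<lambda>t. integral {0..t} (\<lambda>s. \<Sum>k<K. P k s * (lam * tail D (p k) * p k)) / t)
    \<longlongrightarrow> revenue_rate D K lam mu p) at_top"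
proof -
  have int: "P k integrable_on {0..t}" if "k \<le> K" for k t
  proof -
    have "continuous_on {0..} (P k)"
      using fe that unfolding forward_equations_def
      by (intro DERIV_continuous_on) auto
    then show ?thesis
      by (intro integrable_continuous_interval) (rule continuous_on_subset, auto)
  qed
  have "((\<lambda>t. \<Sum>k<K. integral {0..t} (P k) / t * (lam * tail D (p k) * p k))
      \<longlongrightarrow> (\<Sum>k<K. state_prob D K lam mu p k * (lam * tail D (p k) * p k))) at_top"
    by (intro tendsto_sum tendsto_mult_right long_run_state_prob[OF assms]) auto
  moreover have "integral {0..t} (\<lambda>s. \<Sum>k<K. P k s * (lam * tail D (p k) * p k)) / t
      = (\<Sum>k<K. integral {0..t} (P k) / t * (lam * tail D (p k) * p k))" for t
  proof -
    have "integral {0..t} (\<lambda>s. \<Sum>k<K. P k s * (lam * tail D (p k) * p k))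
      = (\<Sum>k<K. integral {0..t} (\<lambda>s. P k s * (lam * tail D (p k) * p k)))"
      using int by (intro integral_sum integrable_on_mult_left) auto
    then show ?thesis by (simp add: sum_divide_distrib)
  qed
  ultimately show ?thesis by (simp add: revenue_rate_def mult.assoc)
qed

end

theory Submission
  imports Defs
begin

text \<open>
  For (b), a system with a larger value of \<open>lam / mu\<close> can raise its prices until its effective loads
  \<open>lam / mu * tail D (p k)\<close> agree with those of the other system; the stationary distribution is then
  the same, and every sale is made at a higher price.

  For (a), let \<open>p\<close> be optimal for \<open>mu\<close>, with revenue rate \<open>\<theta>\<close>, and let \<open>d k\<close> be the cost of having
  \<open>k + 1\<close> instead of \<open>k\<close> busy servers, as given by the Poisson equation
  \<open>\<theta> = lam * tail D (p k) * (p k - d k) + k * mu * d (k - 1)\<close>. By optimality \<open>p k\<close> maximizes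
  \<open>q \<mapsto> lam * tail D q * (q - d k)\<close>. Since blocking has positive probability, some price \<open>q\<close>
  has \<open>lam * tail D q * q > \<theta>\<close>, and induction on \<open>k\<close> gives \<open>d k > 0\<close>. Under the same prices, a
  larger service rate \<open>mu'\<close> changes the drift in state \<open>k\<close> by \<open>k * (mu' - mu) * d (k - 1) \<ge> 0\<close>.
\<close>

section \<open>Tails of valuation distributions\<close>

lemma tail_eq:
  assumes "valuation_distribution D"
  shows "tail D u = 1 - cdf D u"
proof -
  interpret real_distribution D
    using assms by (simp add: valuation_distribution_def)
  have "isCont (cdf D) u"
    using assms by (simp add: valuation_distribution_def continuous_on_eq_continuous_at)
  then have "measure D {u} = 0" by (simp add: isCont_cdf)
  moreover have "measure D ({..u} - {u}) = measure D {..u} - measure D {u}"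
    by (intro finite_measure_Diff) auto
  moreover have "measure D (space D - ({..u} - {u})) = 1 - measure D ({..u} - {u})"
    by (intro prob_compl) auto
  moreover have "space D - ({..u} - {u}) = {u..}" by auto
  ultimately show ?thesis by (simp add: tail_def cdf_def)
qed

lemma tail_0:
  assumes "valuation_distribution D"
  shows "tail D 0 = 1"
proof -
  interpret real_distribution D
    using assms by (simp add: valuation_distribution_def)
  have "AE v in D. v \<in> {0..}"
    using assms unfolding valuation_distribution_def by (auto elim: eventually_mono)
  then show ?thesis
    unfolding tail_def by (subst prob_eq_1) auto
qed

text \<open>The intermediate value theorem applies, as \<open>tail D\<close> is continuous and tends
  to 0. If \<open>tail D u = 0\<close>, then \<open>v = u\<close> serves, which is why strictness is
  conditional.\<close>

lemma exists_scaled_tail: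
  assumes D: "valuation_distribution D" and "0 < c" "c < 1"
  shows "\<exists>v\<ge>u. tail D v = c * tail D u \<and> (0 < tail D u \<longrightarrow> u < v)"
proof (cases "tail D u = 0")
  case False
  then have pos: "0 < tail D u" using tail_nonneg[of D u] by linarith
  interpret real_distribution D
    using D by (simp add: valuation_distribution_def)
  have "(tail D \<longlongrightarrow> 1 - 1) at_top"
    unfolding tail_eq[OF D, abs_def] by (intro tendsto_intros cdf_lim_at_top_prob)
  then have "eventually (\<lambda>x. tail D x < c * tail D u) at_top"
    using pos \<open>0 < c\<close> by (intro order_tendstoD) auto
  then have "eventually (\<lambda>x. tail D x < c * tail D u \<and> u \<le> x) at_top"
    using eventually_ge_at_top[of u] by eventually_elim simp
  then obtain w where w: "tail D w < c * tail D u" "u \<le> w"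
    by (auto simp: eventually_at_top_linorder)
  have "continuous_on {u..w} (tail D)"
    unfolding tail_eq[OF D, abs_def]
    using D by (intro continuous_intros) (auto simp: valuation_distribution_def intro: continuous_on_subset)
  moreover have less: "c * tail D u < tail D u" using pos \<open>c < 1\<close> by simp
  ultimately obtain v where "u \<le> v" "v \<le> w" "tail D v = c * tail D u"
    using IVT2'[of "tail D" w "c * tail D u" u] w by auto
  then show ?thesis using less by (intro exI[of _ v]) (auto simp: less_le)
qed auto

section \<open>Identities for the stationary revenue rate\<close>

lemma revenue_rate_eq:
  "revenue_rate D K lam mu p =
    (\<Sum>k<K. state_weight D lam mu p k * (lam * tail D (p k) * p k)) / (\<Sum>k\<le>K. state_weight D lam mu p k)"
  by (simp add: revenue_rate_def state_prob_def sum_state_weight divide_inverse sum_distrib_left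
      sum_distrib_right mult_ac)

lemma sum_state_weight_pos:
  assumes "0 < lam" "0 < mu"
  shows "0 < (\<Sum>k\<le>K. state_weight D lam mu p k)"
  unfolding sum_state_weight
  using assms by (intro add_pos_nonneg sum_nonneg state_weight_nonneg) auto

text \<open>With \<open>d k = h k - h (k + 1)\<close> this says that \<open>h\<close> has mean drift zero in equilibrium.\<close>

lemma sum_state_weight_drift:
  assumes "0 < mu"
  shows "(\<Sum>k<K. state_weight D lam mu p k * (lam * tail D (p k) * d k))
    = (\<Sum>k\<le>K. state_weight D lam mu p k * (real k * mu * d (k - 1)))"
proof (induction K)
  case (Suc K)
  have "state_weight D lam mu p K * (lam * tail D (p K) * d K)
    = (lam * tail D (p K) * state_weight D lam mu p K) * d K"
    by (simp add: mult_ac)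
  also have "\<dots> = state_weight D lam mu p (Suc K) * (real (Suc K) * mu * d (Suc K - 1))"
    unfolding state_weight_balance[OF assms] by (simp add: mult_ac)
  finally show ?case using Suc by simp
qed simp

text \<open>The drift identity adds terms of total zero. As \<open>d\<close> and
  \<open>\<theta>\<close> are arbitrary, a Poisson solution for one policy or service rate can be
  tested under another.\<close>

lemma revenue_rate_difference:
  assumes "0 < lam" "0 < mu"
  shows "(revenue_rate D K lam mu p - \<theta>) * (\<Sum>k\<le>K. state_weight D lam mu p k) =
    (\<Sum>k<K. state_weight D lam mu p k * (lam * tail D (p k) * (p k - d k) + real k * mu * d (k - 1) - \<theta>))
    + state_weight D lam mu p K * (real K * mu * d (K - 1) - \<theta>)"
proof -
  let ?w = "state_weight D lam mu p"
  have "(revenue_rate D K lam mu p - \<theta>) * sum ?w {..K}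
    = (\<Sum>k<K. ?w k * (lam * tail D (p k) * p k)) - \<theta> * sum ?w {..K}"
    using sum_state_weight_pos[OF assms, of D p K] by (simp add: revenue_rate_eq left_diff_distrib)
  also have "\<dots> = (\<Sum>k<K. ?w k * (lam * tail D (p k) * p k)) - \<theta> * sum ?w {..K}
      - (\<Sum>k<K. ?w k * (lam * tail D (p k) * d k)) + (\<Sum>k\<le>K. ?w k * (real k * mu * d (k - 1)))"
    by (simp add: sum_state_weight_drift[OF assms(2)])
  also have "\<dots> = (\<Sum>k<K. ?w k * (lam * tail D (p k) * (p k - d k) + real k * mu * d (k - 1) - \<theta>))
    + ?w K * (real K * mu * d (K - 1) - \<theta>)"
    by (simp add: sum_distrib_left sum.distrib sum_subtractf algebra_simps flip: lessThan_Suc_atMost)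
  finally show ?thesis .
qed

text \<open>A zero joining probability at \<open>m\<close> puts a zero factor into every later state
  weight.\<close>

lemma revenue_rate_truncate:
  assumes "m \<le> K" and "m < K \<Longrightarrow> tail D (p m) = 0"
  shows "revenue_rate D K lam mu p = revenue_rate D m lam mu p"
proof (cases "m < K")
  case True
  have w: "state_weight D lam mu p k = 0" if "m < k" for k
    using assms(2)[OF True] that by (auto simp: state_weight_def prod_zero_iff)
  have "(\<Sum>k<K. state_weight D lam mu p k * (lam * tail D (p k) * p k))
      = (\<Sum>k<m. state_weight D lam mu p k * (lam * tail D (p k) * p k))"
    using assms(1) assms(2)[OF True] w
    by (intro sum.mono_neutral_right) (auto simp: not_less le_less)
  moreover have "(\<Sum>k\<le>K. state_weight D lam mu p k) = (\<Sum>k\<le>m. state_weight D lam mu p k)"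
    using assms(1) w by (intro sum.mono_neutral_right) auto
  ultimately show ?thesis by (simp add: revenue_rate_eq)
qed (use assms in auto)

lemma exists_revenue_rate_pos:
  assumes D: "valuation_distribution D" and "1 \<le> K" "0 < lam" "0 < mu"
  shows "\<exists>p\<in>price_vectors K. 0 < revenue_rate D K lam mu p"
proof -
  obtain q where q: "0 < q" "tail D q = 1 / 2"
    using exists_scaled_tail[OF D, of "1/2" 0] by (auto simp: tail_0[OF D])
  define p where "p = (\<lambda>k\<in>{..<K}. q)"
  have "0 < (\<Sum>k<K. state_weight D lam mu p k * (lam * tail D (p k) * p k))"
    using assms q by (intro sum_pos) (auto simp: p_def state_weight_def lessThan_empty_iff intro!: prod_pos)
  then have "0 < revenue_rate D K lam mu p"
    unfolding revenue_rate_eq using assms by (intro divide_pos_pos sum_state_weight_pos)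
  moreover have "p \<in> price_vectors K" using q by (auto simp: p_def price_vectors_def)
  ultimately show ?thesis by blast
qed

section \<open>Strict increase in the service rate\<close>

lemma revenue_rate_strict_mono:
  assumes D: "valuation_distribution D" and "1 \<le> K" "0 < lam" "0 < mu" "mu < mu'"
    and p: "p \<in> price_vectors K"
    and opt: "\<And>q. q \<in> price_vectors K \<Longrightarrow> revenue_rate D K lam mu q \<le> revenue_rate D K lam mu p"
  shows "revenue_rate D K lam mu p < revenue_rate D K lam mu' p"
proof -
  define \<theta> where "\<theta> = revenue_rate D K lam mu p"
  have "0 < \<theta>"
    using exists_revenue_rate_pos[OF assms(1-4)] opt unfolding \<theta>_def by force
  \<comment> \<open>States above \<open>m\<close> are never reached, so the chain is that of an \<open>m\<close>-server system
    with positive joining rates.\<close>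
  define m where "m = (LEAST m. m = K \<or> tail D (p m) = 0)"
  have m: "m = K \<or> tail D (p m) = 0"
    unfolding m_def by (rule LeastI[of _ K]) simp
  have "m \<le> K" unfolding m_def by (rule Least_le) simp
  have tail_pos: "0 < tail D (p k)" if "k < m" for k
    using not_less_Least[OF that[unfolded m_def]] tail_nonneg[of D "p k"] by simp
  have trunc: "revenue_rate D K lam \<mu> p' = revenue_rate D m lam \<mu> p'" if "p' m = p m" for \<mu> p'
    using m \<open>m \<le> K\<close> that by (intro revenue_rate_truncate) auto
  have "m \<noteq> 0"
  proof
    assume "m = 0"
    then have "\<theta> = 0" using trunc[of p mu] by (simp add: \<theta>_def revenue_rate_eq[of D 0])
    with \<open>0 < \<theta>\<close> show False by simp
  qed
  have w_pos: "0 < state_weight D lam \<mu> p k" if "k \<le> m" "0 < \<mu>" for k \<mu>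
    using that \<open>0 < lam\<close> tail_pos by (auto simp: state_weight_def intro!: divide_pos_pos mult_pos_pos prod_pos)
  define b where "b q = lam * tail D q" for q
  have b_pos: "0 < b (p k)" if "k < m" for k using tail_pos[OF that] \<open>0 < lam\<close> by (simp add: b_def)
  have b_nonneg: "0 \<le> b q" for q using \<open>0 < lam\<close> by (simp add: b_def tail_nonneg)
  \<comment> \<open>The Poisson equation is solved for \<open>d k\<close> upwards from state 0; the
    divisors \<open>b (p k)\<close> are positive below \<open>m\<close>.\<close>
  define d where "d = rec_nat ((b (p 0) * p 0 - \<theta>) / b (p 0))
    (\<lambda>k x. (b (p (Suc k)) * p (Suc k) - \<theta> + real (Suc k) * mu * x) / b (p (Suc k)))"
  have poisson: "b (p k) * (p k - d k) + real k * mu * d (k - 1) = \<theta>" if "k < m" for k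
    using b_pos[OF that] by (cases k) (simp_all add: d_def field_simps)
  \<comment> \<open>The recursion does not impose the equation at the full state \<open>m\<close>.
    It follows because \<open>\<theta>\<close> is the revenue rate of \<open>p\<close>: the
    difference identity leaves only this term, with positive weight.\<close>
  have "(revenue_rate D m lam mu p - \<theta>) * sum (state_weight D lam mu p) {..m}
      = state_weight D lam mu p m * (real m * mu * d (m - 1) - \<theta>)"
    unfolding revenue_rate_difference[OF \<open>0 < lam\<close> \<open>0 < mu\<close>, where d = d]
    using poisson by (auto simp: b_def)
  then have poisson_m: "real m * mu * d (m - 1) = \<theta>"
    using w_pos[of m mu] \<open>0 < mu\<close> by (simp add: \<theta>_def trunc)

  \<comment> \<open>Changing one price keeps all other Poisson equations intact, so the difference
    identity reduces to the bracket at \<open>k\<close>, which optimality makes nonpositive.\<close>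
  have maximal: "b q * (q - d k) \<le> b (p k) * (p k - d k)" if "k < m" "0 \<le> q" for k q
  proof -
    let ?p = "p(k := q)"
    have w: "state_weight D lam mu ?p k = state_weight D lam mu p k"
      by (simp add: state_weight_def)
    have "?p \<in> price_vectors K"
      using p that \<open>m \<le> K\<close> by (auto simp: price_vectors_def PiE_iff extensional_def)
    then have "revenue_rate D m lam mu ?p - \<theta> \<le> 0"
      using opt[of ?p] trunc[of ?p mu] that by (simp add: \<theta>_def)
    then have "(revenue_rate D m lam mu ?p - \<theta>) * sum (state_weight D lam mu ?p) {..m} \<le> 0"
      using sum_state_weight_pos[OF \<open>0 < lam\<close> \<open>0 < mu\<close>, of D ?p m] by (simp add: mult_le_0_iff)
    then have "(\<Sum>j<m. state_weight D lam mu ?p j *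
        (b (?p j) * (?p j - d j) + real j * mu * d (j - 1) - \<theta>)) \<le> 0"
      unfolding revenue_rate_difference[OF \<open>0 < lam\<close> \<open>0 < mu\<close>, where d = d] poisson_m
      by (simp add: b_def)
    also have "(\<Sum>j<m. state_weight D lam mu ?p j *
        (b (?p j) * (?p j - d j) + real j * mu * d (j - 1) - \<theta>))
      = (\<Sum>j<m. if j = k then state_weight D lam mu p k *
        (b q * (q - d k) + real k * mu * d (k - 1) - \<theta>) else 0)"
      using poisson w by (intro sum.cong) auto
    also have "\<dots> = state_weight D lam mu p k * (b q * (q - d k) + real k * mu * d (k - 1) - \<theta>)"
      using that by simp
    finally show ?thesis
      using w_pos[of k mu] \<open>0 < mu\<close> poisson[of k] that by (auto simp: mult_le_0_iff)
  qed

  \<comment> \<open>The full state has positive probability and earns nothing, so the average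
    \<open>\<theta>\<close> is exceeded in some other state.\<close>
  have "\<exists>k<m. \<theta> < b (p k) * p k"
  proof (rule ccontr)
    assume "\<not> ?thesis"
    then have "b (p k) * p k \<le> \<theta>" if "k < m" for k
      using that by (meson not_less)
    then have "(\<Sum>k<m. state_weight D lam mu p k * (b (p k) * p k)) \<le> (\<Sum>k<m. state_weight D lam mu p k * \<theta>)"
      using assms by (intro sum_mono mult_left_mono state_weight_nonneg) auto
    also have "\<dots> < (\<Sum>k\<le>m. state_weight D lam mu p k * \<theta>)"
      using w_pos[of m mu] \<open>0 < mu\<close> \<open>0 < \<theta>\<close> by (simp flip: lessThan_Suc_atMost)
    also have "\<dots> = \<theta> * (\<Sum>k\<le>m. state_weight D lam mu p k)"
      by (simp add: sum_distrib_left mult.commute)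
    also have "\<dots> = (\<Sum>k<m. state_weight D lam mu p k * (b (p k) * p k))"
      using sum_state_weight_pos[OF \<open>0 < lam\<close> \<open>0 < mu\<close>, of D p m]
        trunc[of p mu] by (simp add: \<theta>_def revenue_rate_eq[of D m] b_def)
    finally show False by simp
  qed
  then obtain k\<^sub>0 where k\<^sub>0: "k\<^sub>0 < m" "\<theta> < b (p k\<^sub>0) * p k\<^sub>0" by blast
  define q where "q = p k\<^sub>0"
  have q: "0 \<le> q" "\<theta> < b q * q"
    using p k\<^sub>0 \<open>m \<le> K\<close> by (auto simp: q_def price_vectors_def PiE_iff)
  \<comment> \<open>A nonpositive cost can only raise the margin of \<open>q\<close>, and
    \<open>p k\<close> does at least as well as \<open>q\<close>.\<close>
  have gain: "\<theta> < b (p k) * (p k - d k)" if "k < m" "d k \<le> 0" for k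
  proof -
    have "b q * q \<le> b q * (q - d k)" using that b_nonneg by (intro mult_left_mono) auto
    also have "\<dots> \<le> b (p k) * (p k - d k)" using that q by (intro maximal)
    finally show ?thesis using q by linarith
  qed
  \<comment> \<open>If \<open>d k \<le> 0\<close>, the sales term exceeds \<open>\<theta>\<close>;
    yet the Poisson equation makes it \<open>\<theta>\<close> minus a departure term that is zero at
    \<open>k = 0\<close> and positive by induction afterwards.\<close>
  have d_pos: "0 < d k" if "k < m" for k
    using that
  proof (induction k)
    case 0
    then show ?case using gain[of 0] poisson[of 0] by force
  next
    case (Suc k)
    then have "0 < real (Suc k) * mu * d (Suc k - 1)" using \<open>0 < mu\<close> by simp
    then show ?case using gain[OF Suc.prems] poisson[OF Suc.prems] by linarith
  qed

  have mu': "0 < mu'" using assms by simp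
  \<comment> \<open>Only the departure term depends on the service rate; \<open>x\<close> is the
    sales term, which is 0 in the full state.\<close>
  have drift: "x + real k * mu' * d (k - 1) - \<theta> = real k * (mu' - mu) * d (k - 1)"
    if "x + real k * mu * d (k - 1) = \<theta>" for x k
    using that by (simp add: algebra_simps)
  have "(revenue_rate D m lam mu' p - \<theta>) * sum (state_weight D lam mu' p) {..m}
    = (\<Sum>k<m. state_weight D lam mu' p k * (real k * (mu' - mu) * d (k - 1)))
      + state_weight D lam mu' p m * (real m * (mu' - mu) * d (m - 1))"
    unfolding revenue_rate_difference[OF \<open>0 < lam\<close> mu', where d = d]
    using drift[OF poisson] drift[of 0 m] poisson_m by (simp add: b_def)
  also have "\<dots> > 0"
  proof (intro add_nonneg_pos sum_nonneg)
    show "0 \<le> state_weight D lam mu' p k * (real k * (mu' - mu) * d (k - 1))" if "k \<in> {..<m}" for k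
      using that w_pos[of k mu'] mu' \<open>mu < mu'\<close> less_imp_le[OF d_pos[of "k - 1"]]
      by (intro mult_nonneg_nonneg) auto
    show "0 < state_weight D lam mu' p m * (real m * (mu' - mu) * d (m - 1))"
      using w_pos[of m mu'] mu' \<open>mu < mu'\<close> d_pos[of "m - 1"] \<open>m \<noteq> 0\<close> by simp
  qed
  finally show ?thesis
    using sum_state_weight_pos[OF \<open>0 < lam\<close> mu', of D p m] by (simp add: zero_less_mult_iff \<theta>_def trunc)
qed

section \<open>Strict decrease of revenue per unit of service rate\<close>

lemma exists_better_revenue_rate_per_service:
  assumes D: "valuation_distribution D" and "0 < lam" "0 < mu" "mu < mu'"
    and p: "p \<in> price_vectors K" and pos: "0 < revenue_rate D K lam mu' p"
  shows "\<exists>p'\<in>price_vectors K. revenue_rate D K lam mu' p / mu' < revenue_rate D K lam mu p' / mu"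
proof -
  \<comment> \<open>The factor \<open>mu / mu'\<close> equalises the loads:
    \<open>lam / mu * tail D (v k) = lam / mu' * tail D (p k)\<close>.\<close>
  have "\<forall>k. \<exists>v\<ge>p k. tail D v = mu / mu' * tail D (p k) \<and> (0 < tail D (p k) \<longrightarrow> p k < v)"
    using assms by (intro allI exists_scaled_tail) auto
  then obtain v where v: "\<And>k. p k \<le> v k" "\<And>k. tail D (v k) = mu / mu' * tail D (p k)"
      "\<And>k. 0 < tail D (p k) \<Longrightarrow> p k < v k"
    by metis
  define p' where "p' = restrict v {..<K}"
  have p'_eq: "p' k = v k" if "k < K" for k using that by (simp add: p'_def)
  have p': "p' \<in> price_vectors K"
    using p v(1) by (auto simp: p'_def price_vectors_def PiE_iff intro: order_trans)
  have w: "state_weight D lam mu p' k = state_weight D lam mu' p k" if "k \<le> K" for k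
  proof -
    have "(\<Prod>j<k. tail D (p' j)) = (mu / mu') ^ k * (\<Prod>j<k. tail D (p j))"
      using that by (simp add: p'_eq v prod.distrib prod_dividef power_divide)
    then show ?thesis using assms
      by (simp add: state_weight_def power_divide)
  qed
  have "K \<noteq> 0" using pos by (intro notI) (simp add: revenue_rate_eq)
  \<comment> \<open>If no job joined the empty system, truncation to zero servers would give zero
    revenue.\<close>
  have "tail D (p 0) \<noteq> 0"
    using pos revenue_rate_truncate[of 0 K D p lam mu'] by (auto simp: revenue_rate_eq)
  then have "0 < tail D (p 0)" using tail_nonneg[of D "p 0"] by simp
  let ?r = "\<lambda>x k. state_weight D lam mu' p k * (lam / mu' * tail D (p k) * x k)"
  have "revenue_rate D K lam mu' p / mu' = (\<Sum>k<K. ?r p k) / (\<Sum>k\<le>K. state_weight D lam mu' p k)"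
    by (simp add: revenue_rate_eq sum_divide_distrib mult_ac)
  also have "\<dots> < (\<Sum>k<K. ?r v k) / (\<Sum>k\<le>K. state_weight D lam mu' p k)"
  proof (intro divide_strict_right_mono sum_strict_mono_ex1)
    show "\<forall>k\<in>{..<K}. ?r p k \<le> ?r v k"
      using assms v(1) by (auto intro!: divide_right_mono mult_left_mono mult_nonneg_nonneg state_weight_nonneg tail_nonneg)
    \<comment> \<open>The empty state has weight 1, so its strict price increase makes the
      comparison of the sums strict.\<close>
    have "?r p 0 < ?r v 0"
      using assms v(3)[of 0] \<open>0 < tail D (p 0)\<close> by (auto intro!: divide_strict_right_mono mult_strict_left_mono)
    then show "\<exists>k\<in>{..<K}. ?r p k < ?r v k" using \<open>K \<noteq> 0\<close> by (intro bexI[of _ 0]) auto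
  qed (use assms sum_state_weight_pos[of lam mu' D p K] in auto)
  also have "\<dots> = revenue_rate D K lam mu p' / mu"
  proof -
    have "(\<Sum>k<K. ?r v k) = (\<Sum>k<K. state_weight D lam mu p' k * (lam * tail D (p' k) * p' k)) / mu"
      unfolding sum_divide_distrib using assms
      by (intro sum.cong) (auto simp: w p'_eq v field_simps)
    then show ?thesis by (simp add: revenue_rate_eq w)
  qed
  finally show ?thesis using p' by blast
qed

theorem proposition21:
  fixes D :: "real measure" and K :: nat and lam :: real
  assumes "valuation_distribution D" and "1 \<le> K" and "0 < lam"
    and "\<forall>mu>0. \<exists>p. is_arg_max (revenue_rate D K lam mu) (\<lambda>p. p \<in> price_vectors K) p"
  shows "strict_mono_on {0<..} (\<lambda>mu. optimal_revenue_rate D K lam mu)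
    \<and> strict_antimono_on {0<..} (\<lambda>mu. optimal_revenue_rate D K lam mu / mu)"
proof -
  let ?V = "price_vectors K"
  have opt: "\<exists>p\<in>?V. optimal_revenue_rate D K lam mu = revenue_rate D K lam mu p \<and>
      (\<forall>q\<in>?V. revenue_rate D K lam mu q \<le> revenue_rate D K lam mu p)" if "0 < mu" for mu
    using assms(4) that optimal_revenue_rate_eq by (metis (no_types, lifting) is_arg_max_linorder)
  show ?thesis
  proof (intro conjI monotone_onI)
    fix mu mu' :: real assume "mu \<in> {0<..}" "mu' \<in> {0<..}" "mu < mu'"
    then have mu: "0 < mu" "0 < mu'" "mu < mu'" by auto
    obtain p where p: "p \<in> ?V" "optimal_revenue_rate D K lam mu = revenue_rate D K lam mu p"
      "\<forall>q\<in>?V. revenue_rate D K lam mu q \<le> revenue_rate D K lam mu p"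
      using opt[OF mu(1)] by blast
    obtain p' where p': "p' \<in> ?V" "optimal_revenue_rate D K lam mu' = revenue_rate D K lam mu' p'"
      "\<forall>q\<in>?V. revenue_rate D K lam mu' q \<le> revenue_rate D K lam mu' p'"
      using opt[OF mu(2)] by blast
    \<comment> \<open>The prices \<open>p\<close> stay feasible at \<open>mu'\<close>, so the
      optimum there is at least their improved revenue.\<close>
    have "revenue_rate D K lam mu p < revenue_rate D K lam mu' p"
      using assms mu p by (intro revenue_rate_strict_mono) auto
    also have "\<dots> \<le> revenue_rate D K lam mu' p'" using p p' by blast
    finally show "optimal_revenue_rate D K lam mu < optimal_revenue_rate D K lam mu'"
      by (simp add: p p')
    have "0 < revenue_rate D K lam mu' p'"
      using exists_revenue_rate_pos[OF assms(1-3) mu(2)] p'(3) by force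
    then obtain q where q: "q \<in> ?V" "revenue_rate D K lam mu' p' / mu' < revenue_rate D K lam mu q / mu"
      using exists_better_revenue_rate_per_service[OF assms(1,3) mu(1,3) p'(1)] by blast
    have "revenue_rate D K lam mu q / mu \<le> revenue_rate D K lam mu p / mu"
      using p(3) q(1) mu(1) by (intro divide_right_mono) auto
    with q show "optimal_revenue_rate D K lam mu / mu > optimal_revenue_rate D K lam mu' / mu'"
      by (simp add: p p')
  qed
qed

end
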